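(* Let $Y\subseteq\mathbb{R}^2$ be a finite union $$Y=\{g_1>0,\dots,g_m>0\}\cup\{g'_1>0,\dots,g'_{m'}>0\}\cup\dots\cup\{g''_1>0,\dots,g''_{m''}>0\},$$ where all the polynomials $g_j,g'_j,\dots,g''_j\in\mathbb{R}[x,y]$ are irreducible. Then there exists a cell decomposition $\mathcal{A}$ of $Y$ such that $(Y,\mathcal{A})$ is a CW complex and $\mathcal{A}$ has the finiteness property.
   Context: A cell decomposition of a set $X\subseteq\mathbb{R}^2$ is a partition of $X$ into (finitely or countably many) cells, each of which is a semi-algebraic set: 0-cells are points, 1-cells are subsets homeomorphic to an open interval, 2-cells are subsets homeomorphic to an open disk. A shortest-length curve in $X$ between two points $A,B\in X$ is a piecewise $C^2$ curve $\gamma$ from $A$ to $B$ lying entirely in $X$ whose length is minimal among all piecewise $C^2$ curves in $X$ from $A$ to $B$. A geodesic line segment (relative to the decomposition) is either a straight line segment or a connected arc contained (partially or entirely) in a 1-cell. A cell decomposition $\mathcal{A}$ of $X$ has the finiteness property if for every shortest-length curve $\gamma$ in $X$ between two points of $X$ and every cell $e\in\mathcal{A}$, the set $\gamma\cap e$ is either empty or has finitely many connected components, each of which is either a singleton or a geodesic line segment. *)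

theory Defs
  imports "HOL-Analysis.Analysis" "HOL-Computational_Algebra.Polynomial"
begin

text \<open>R[x,y] is represented as (R[x])[y], i.e. the type real poly poly:
  the outer variable is y, the coefficients are polynomials in x.
  Irreducibility is the library notion irreducible in this ring.\<close>

definition peval2 :: "real poly poly \<Rightarrow> real \<times> real \<Rightarrow> real" where
  "peval2 p z = poly (map_poly (\<lambda>c. poly c (fst z)) p) (snd z)"

inductive_set semialgebraic :: "(real \<times> real) set set" where
  sa_pos: "{z. peval2 p z > 0} \<in> semialgebraic"
| sa_zero: "{z. peval2 p z = 0} \<in> semialgebraic"
| sa_compl: "S \<in> semialgebraic \<Longrightarrow> - S \<in> semialgebraic"
| sa_union: "S \<in> semialgebraic \<Longrightarrow> T \<in> semialgebraic \<Longrightarrow> S \<union> T \<in> semialgebraic"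
| sa_inter: "S \<in> semialgebraic \<Longrightarrow> T \<in> semialgebraic \<Longrightarrow> S \<inter> T \<in> semialgebraic"

definition open_disk :: "nat \<Rightarrow> (real \<times> real) set" where
  "open_disk n = (if n = 0 then {(0,0)}
                  else if n = 1 then {-1<..<1} \<times> {0}
                  else ball 0 1)"

definition disk :: "nat \<Rightarrow> (real \<times> real) set" where
  "disk n = (if n = 0 then {(0,0)}
             else if n = 1 then {-1..1} \<times> {0}
             else cball 0 1)"

definition disk_boundary :: "nat \<Rightarrow> (real \<times> real) set" where
  "disk_boundary n = (if n = 0 then {}
                      else if n = 1 then {(-1,0), (1,0)}
                      else sphere 0 1)"

definition is_cell :: "nat \<Rightarrow> (real \<times> real) set \<Rightarrow> bool" where
  "is_cell n e \<longleftrightarrow> n \<le> 2 \<and> e homeomorphic open_disk n"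

definition cell_decomposition :: "(real \<times> real) set \<Rightarrow> (real \<times> real) set set \<Rightarrow> bool" where
  "cell_decomposition X \<A> \<longleftrightarrow>
     countable \<A> \<and> \<Union>\<A> = X \<and> {} \<notin> \<A> \<and>
     (\<forall>e\<in>\<A>. \<forall>e'\<in>\<A>. e \<noteq> e' \<longrightarrow> e \<inter> e' = {}) \<and>
     (\<forall>e\<in>\<A>. e \<in> semialgebraic \<and> (\<exists>n. is_cell n e))"

definition skeleton_below :: "(real \<times> real) set set \<Rightarrow> nat \<Rightarrow> (real \<times> real) set" where
  "skeleton_below \<A> n = \<Union>{e\<in>\<A>. \<exists>k<n. is_cell k e}"

definition CW_complex :: "(real \<times> real) set \<Rightarrow> (real \<times> real) set set \<Rightarrow> bool" where
  "CW_complex Y \<A> \<longleftrightarrow>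
     cell_decomposition Y \<A> \<and>
     (\<forall>e\<in>\<A>. \<exists>n \<Phi>. is_cell n e \<and> continuous_on (disk n) \<Phi> \<and> \<Phi> ` disk n \<subseteq> Y \<and>
                   (\<exists>\<Psi>. homeomorphism (open_disk n) e \<Phi> \<Psi>) \<and>
                   \<Phi> ` disk_boundary n \<subseteq> skeleton_below \<A> n) \<and>
     (\<forall>e\<in>\<A>. finite {e'\<in>\<A>. e' \<inter> (Y \<inter> closure e) \<noteq> {}}) \<and>
     (\<forall>A. A \<subseteq> Y \<longrightarrow>
        (closedin (top_of_set Y) A \<longleftrightarrow>
         (\<forall>e\<in>\<A>. closedin (top_of_set (Y \<inter> closure e)) (A \<inter> (Y \<inter> closure e)))))"

definition C2_on :: "real set \<Rightarrow> (real \<Rightarrow> real \<times> real) \<Rightarrow> bool" where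
  "C2_on S \<gamma> \<longleftrightarrow> (\<exists>\<gamma>1 \<gamma>2. continuous_on S \<gamma>2 \<and>
     (\<forall>t\<in>S. (\<gamma> has_vector_derivative \<gamma>1 t) (at t within S) \<and>
             (\<gamma>1 has_vector_derivative \<gamma>2 t) (at t within S)))"

definition piecewise_C2 :: "(real \<Rightarrow> real \<times> real) \<Rightarrow> bool" where
  "piecewise_C2 \<gamma> \<longleftrightarrow> (\<exists>k (t::nat \<Rightarrow> real). t 0 = 0 \<and> t k = 1 \<and>
     (\<forall>i<k. t i < t (Suc i) \<and> C2_on {t i..t (Suc i)} \<gamma>))"

definition curve_length :: "(real \<Rightarrow> real \<times> real) \<Rightarrow> real" where
  "curve_length \<gamma> = integral {0..1} (\<lambda>t. norm (vector_derivative \<gamma> (at t)))"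

definition curve_in :: "(real \<times> real) set \<Rightarrow> real \<times> real \<Rightarrow> real \<times> real \<Rightarrow> (real \<Rightarrow> real \<times> real) \<Rightarrow> bool" where
  "curve_in X A B \<gamma> \<longleftrightarrow> piecewise_C2 \<gamma> \<and> \<gamma> 0 = A \<and> \<gamma> 1 = B \<and> \<gamma> ` {0..1} \<subseteq> X"

definition shortest_curve :: "(real \<times> real) set \<Rightarrow> real \<times> real \<Rightarrow> real \<times> real \<Rightarrow> (real \<Rightarrow> real \<times> real) \<Rightarrow> bool" where
  "shortest_curve X A B \<gamma> \<longleftrightarrow> curve_in X A B \<gamma> \<and>
     (\<forall>\<delta>. curve_in X A B \<delta> \<longrightarrow> curve_length \<gamma> \<le> curve_length \<delta>)"

definition straight_segment :: "(real \<times> real) set \<Rightarrow> bool" where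
  "straight_segment C \<longleftrightarrow> (\<exists>a b. a \<noteq> b \<and> open_segment a b \<subseteq> C \<and> C \<subseteq> closed_segment a b)"

definition geodesic_segment :: "(real \<times> real) set set \<Rightarrow> (real \<times> real) set \<Rightarrow> bool" where
  "geodesic_segment \<A> C \<longleftrightarrow> straight_segment C \<or>
     (\<exists>e\<in>\<A>. is_cell 1 e \<and> C \<subseteq> e \<and> connected C \<and> C \<noteq> {} \<and> \<not> (\<exists>p. C = {p}))"

definition finiteness_property :: "(real \<times> real) set \<Rightarrow> (real \<times> real) set set \<Rightarrow> bool" where
  "finiteness_property X \<A> \<longleftrightarrow>
     (\<forall>A B \<gamma>. A \<in> X \<longrightarrow> B \<in> X \<longrightarrow> shortest_curve X A B \<gamma> \<longrightarrow>
        (\<forall>e\<in>\<A>. \<gamma> ` {0..1} \<inter> e = {} \<or>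
           (finite (components (\<gamma> ` {0..1} \<inter> e)) \<and>
            (\<forall>C\<in>components (\<gamma> ` {0..1} \<inter> e). (\<exists>p. C = {p}) \<or> geodesic_segment \<A> C))))"

definition basic_union :: "real poly poly list list \<Rightarrow> (real \<times> real) set" where
  "basic_union G = (\<Union>gs\<in>set G. {z. \<forall>g\<in>set gs. peval2 g z > 0})"

end

(* Y is open, and this is all that is used about it. Each point z of Y is put into the largest dyadic
   cell (vertex, open edge or open square) around it whose closed star at the same level lies in Y. Dyadic
   cells of different levels are nested or disjoint, so these cells partition Y; they are locally finite
   and the boundary of each of them lies in finer or equally fine cells of smaller dimension.
   All cells are convex. A shortest curve in an open set is a straight segment: short chords lie in the
   set, so replacing an arc by its chord shows that arcs of small length are as long as their chords,
   and local straightness propagates. Hence a shortest curve meets every cell in a convex subset of a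
   segment. *)
theory Submission
  imports Defs
begin

section \<open>Shortest curves in open sets\<close>

text \<open>The finiteness property quantifies only over minimisers that exist. In an open set they
  may fail to exist, for instance for two opposite points outside a closed disk, where a taut path
  would have to touch the missing boundary; but one that does exist stays at positive distance from
  the complement, and that room is what makes it straight. The price of openness is topological: the
  closure of each selected cell is a compact subset of \<open>Y\<close>, so a nonempty
  \<open>Y\<close> needs infinitely many cells, and the weak topology has to be obtained from local
  finiteness. The selection is a Whitney type decomposition, with side lengths comparable to the
  distance to the complement and capped at 1; making it a CW complex requires control of how cells
  of different sizes meet along their boundaries.\<close>

text \<open>Free endpoints and a recursive chain of pieces turn restriction, concatenation and
  estimates of length into inductions. Consecutive pieces share only their common endpoint, so
  corners are allowed there.\<close>

inductive pw_C2 :: "real \<Rightarrow> real \<Rightarrow> (real \<Rightarrow> real \<times> real) \<Rightarrow> bool" where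
  single: "a < b \<Longrightarrow> C2_on {a..b} \<gamma> \<Longrightarrow> pw_C2 a b \<gamma>"
| step: "a < b \<Longrightarrow> C2_on {a..b} \<gamma> \<Longrightarrow> pw_C2 b c \<gamma> \<Longrightarrow> pw_C2 a c \<gamma>"

lemma C2_on_subset: "C2_on S \<gamma> \<Longrightarrow> T \<subseteq> S \<Longrightarrow> C2_on T \<gamma>"
  unfolding C2_on_def
  by (meson continuous_on_subset has_vector_derivative_within_subset subset_iff)

lemma C2_on_cong:
  assumes "C2_on S \<gamma>" "\<And>t. t \<in> S \<Longrightarrow> \<delta> t = \<gamma> t"
  shows "C2_on S \<delta>"
  using assms(1) unfolding C2_on_def
  by (meson assms(2) has_vector_derivative_transform)

lemma C2_on_affine: "C2_on S (\<lambda>t. p + (t - s) *\<^sub>R v)"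
  unfolding C2_on_def
  by (rule exI[of _ "\<lambda>_. v"], rule exI[of _ "\<lambda>_. 0"])
     (auto intro!: derivative_eq_intros continuous_intros)

lemma C2_on_imp_continuous_on: "C2_on S \<gamma> \<Longrightarrow> continuous_on S \<gamma>"
  unfolding C2_on_def
  by (meson continuous_on_eq_continuous_within has_vector_derivative_continuous)

lemma pw_C2_less: "pw_C2 a b \<gamma> \<Longrightarrow> a < b"
  by (induction rule: pw_C2.induct) auto

lemma pw_C2_append: "pw_C2 a b \<gamma> \<Longrightarrow> pw_C2 b c \<gamma> \<Longrightarrow> pw_C2 a c \<gamma>"
  by (induction rule: pw_C2.induct) (auto intro: pw_C2.step)

lemma pw_C2_subinterval: "pw_C2 a b \<gamma> \<Longrightarrow> a \<le> c \<Longrightarrow> c < d \<Longrightarrow> d \<le> b \<Longrightarrow> pw_C2 c d \<gamma>"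
proof (induction arbitrary: c d rule: pw_C2.induct)
  case (single a b \<gamma>)
  then show ?case by (auto intro!: pw_C2.single elim: C2_on_subset)
next
  case (step a b \<gamma> e)
  consider "b \<le> c" | "d \<le> b" | "c < b" "b < d" by linarith
  then show ?case
  proof cases
    case 1
    then show ?thesis using step by simp
  next
    case 2
    then show ?thesis using step by (auto intro!: pw_C2.single elim: C2_on_subset)
  next
    case 3
    then have "C2_on {c..b} \<gamma>"
      using step.prems step.hyps(2) by (auto elim: C2_on_subset)
    then show ?thesis using 3 step by (auto intro: pw_C2.step)
  qed
qed

lemma pw_C2_cong:
  "pw_C2 a b \<gamma> \<Longrightarrow> (\<And>t. a \<le> t \<Longrightarrow> t \<le> b \<Longrightarrow> \<delta> t = \<gamma> t) \<Longrightarrow> pw_C2 a b \<delta>"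
proof (induction rule: pw_C2.induct)
  case (single a b \<gamma>)
  then show ?case by (auto intro!: pw_C2.single elim: C2_on_cong)
next
  case (step a b \<gamma> c)
  have "b < c" using pw_C2_less step.hyps(3) .
  then have "C2_on {a..b} \<delta>"
    using step by (intro C2_on_cong[OF step.hyps(2)]) auto
  moreover have "pw_C2 b c \<delta>" using step.IH step.prems step.hyps(1) by simp
  ultimately show ?case using pw_C2.step[OF step.hyps(1)] by blast
qed

lemma pw_C2_imp_continuous_on: "pw_C2 a b \<gamma> \<Longrightarrow> continuous_on {a..b} \<gamma>"
proof (induction rule: pw_C2.induct)
  case (single a b \<gamma>)
  then show ?case by (simp add: C2_on_imp_continuous_on)
next
  case (step a b \<gamma> c)
  have "{a..b} \<union> {b..c} = {a..c}" using step pw_C2_less[OF step.hyps(3)] by auto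
  then show ?case
    using continuous_on_closed_Un[of "{a..b}" "{b..c}" \<gamma>] C2_on_imp_continuous_on step by auto
qed

lemma piecewise_C2_iff_pw_C2: "piecewise_C2 \<gamma> \<longleftrightarrow> pw_C2 0 1 \<gamma>"
proof
  have *: "pw_C2 (t 0) (t (Suc k)) \<gamma>"
    if "\<forall>i<Suc k. t i < t (Suc i) \<and> C2_on {t i..t (Suc i)} \<gamma>" for t :: "nat \<Rightarrow> real" and k
    using that
  proof (induction k arbitrary: t)
    case 0
    then show ?case by (auto intro: pw_C2.single)
  next
    case (Suc k)
    from Suc.IH[of "t \<circ> Suc"] Suc.prems have "pw_C2 (t 1) (t (Suc (Suc k))) \<gamma>" by simp
    then show ?case using Suc.prems by (auto intro!: pw_C2.step[of "t 0" "t 1"])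
  qed
  assume "piecewise_C2 \<gamma>"
  then obtain k and t :: "nat \<Rightarrow> real" where t: "t 0 = 0" "t k = 1"
      "\<forall>i<k. t i < t (Suc i) \<and> C2_on {t i..t (Suc i)} \<gamma>"
    unfolding piecewise_C2_def by blast
  \<comment> \<open>The case \<open>k = 0\<close> is excluded by \<open>t 0 = 0\<close> and
    \<open>t k = 1\<close>.\<close>
  then show "pw_C2 0 1 \<gamma>" using *[of "k - 1" t] by (cases k) auto
next
  have "\<exists>k (t::nat \<Rightarrow> real). t 0 = a \<and> t k = b \<and>
          (\<forall>i<k. t i < t (Suc i) \<and> C2_on {t i..t (Suc i)} \<gamma>)" if "pw_C2 a b \<gamma>" for a b
    using that
  proof (induction rule: pw_C2.induct)
    case (single a b \<gamma>)
    then show ?case by (intro exI[of _ 1] exI[of _ "case_nat a (\<lambda>_. b)"]) auto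
  next
    case (step a b \<gamma> c)
    then obtain k and t :: "nat \<Rightarrow> real" where t: "t 0 = b" "t k = c"
      "\<forall>i<k. t i < t (Suc i) \<and> C2_on {t i..t (Suc i)} \<gamma>" by blast
    show ?case
      by (rule exI[of _ "Suc k"], rule exI[of _ "case_nat a t"])
         (use t step in \<open>auto simp: less_Suc_eq_0_disj\<close>)
  qed
  then show "pw_C2 0 1 \<gamma> \<Longrightarrow> piecewise_C2 \<gamma>" unfolding piecewise_C2_def by blast
qed

section \<open>Length as the integral of speed\<close>

text \<open>\<open>curve_length\<close> integrates the two-sided derivative, which a C2 piece
  controls only in its interior. The one-sided derivative \<open>\<gamma>1\<close> is continuous up
  to the endpoints and has the same norm except possibly there, so integrability and the chord bound
  transfer from it.\<close>

lemma C2_on_speed_integral: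
  assumes "a < b" "C2_on {a..b} \<gamma>"
  shows "(\<lambda>t. norm (vector_derivative \<gamma> (at t))) integrable_on {a..b}"
    and "norm (\<gamma> b - \<gamma> a) \<le> integral {a..b} (\<lambda>t. norm (vector_derivative \<gamma> (at t)))"
proof -
  obtain \<gamma>1 \<gamma>2 where d: "\<And>t. t \<in> {a..b} \<Longrightarrow> (\<gamma> has_vector_derivative \<gamma>1 t) (at t within {a..b})"
    "\<And>t. t \<in> {a..b} \<Longrightarrow> (\<gamma>1 has_vector_derivative \<gamma>2 t) (at t within {a..b})"
    using assms unfolding C2_on_def by blast
  have cont: "continuous_on {a..b} \<gamma>1"
    by (meson d(2) continuous_on_eq_continuous_within has_vector_derivative_continuous)
  have eq: "norm (\<gamma>1 t) = norm (vector_derivative \<gamma> (at t))" if "t \<in> {a..b} - {a,b}" for t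
    using d(1)[of t] that by (metis Diff_iff at_within_Icc_at atLeastAtMost_iff insert_iff order_le_less
      vector_derivative_at)
  have "(\<lambda>t. norm (\<gamma>1 t)) integrable_on {a..b}"
    by (intro integrable_continuous_interval continuous_on_norm cont)
  then show "(\<lambda>t. norm (vector_derivative \<gamma> (at t))) integrable_on {a..b}"
        by (rule integrable_spike_finite[of "{a,b}", rotated 2]) (use eq in auto)
  have 2: "integral {a..b} (\<lambda>t. norm (\<gamma>1 t)) = integral {a..b} (\<lambda>t. norm (vector_derivative \<gamma> (at t)))"
    by (rule integral_spike[of "{a,b}"]) (use eq in auto)
  have "(\<gamma>1 has_integral (\<gamma> b - \<gamma> a)) {a..b}"
    using assms d(1) by (intro fundamental_theorem_of_calculus) auto
  moreover have "norm (integral {a..b} \<gamma>1) \<le> integral {a..b} (\<lambda>t. norm (\<gamma>1 t))"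
    by (intro integral_norm_bound_integral integrable_continuous_interval continuous_on_norm cont) auto
  ultimately show "norm (\<gamma> b - \<gamma> a) \<le> integral {a..b} (\<lambda>t. norm (vector_derivative \<gamma> (at t)))"
    using 2 by (simp add: integral_unique)
qed

lemma pw_C2_speed_integral:
  assumes "pw_C2 a b \<gamma>"
  shows "(\<lambda>t. norm (vector_derivative \<gamma> (at t))) integrable_on {a..b} \<and>
         norm (\<gamma> b - \<gamma> a) \<le> integral {a..b} (\<lambda>t. norm (vector_derivative \<gamma> (at t)))"
  using assms
proof (induction rule: pw_C2.induct)
  case (single a b \<gamma>)
  then show ?case using C2_on_speed_integral by blast
next
  case (step a b \<gamma> c)
  let ?f = "\<lambda>t. norm (vector_derivative \<gamma> (at t))"
  have ab: "?f integrable_on {a..b}" "norm (\<gamma> b - \<gamma> a) \<le> integral {a..b} ?f"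
    using C2_on_speed_integral step by blast+
  have le: "a \<le> b" "b \<le> c" using step pw_C2_less[OF step.hyps(3)] by auto
  have int: "?f integrable_on {a..c}"
    using Henstock_Kurzweil_Integration.integrable_combine[OF le ab(1)] step.IH by blast
  have "integral {a..b} ?f + integral {b..c} ?f = integral {a..c} ?f"
    by (rule Henstock_Kurzweil_Integration.integral_combine[OF le int])
  moreover have "norm (\<gamma> c - \<gamma> a) \<le> norm (\<gamma> b - \<gamma> a) + norm (\<gamma> c - \<gamma> b)"
    using norm_triangle_ineq[of "\<gamma> b - \<gamma> a" "\<gamma> c - \<gamma> b"] by simp
  ultimately show ?case using ab(2) step.IH int by linarith
qed

text \<open>Closeness is measured by \<open>L\<close> rather than by the parameter: \<open>\<gamma>\<close> may pause, and subdividing at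
  values of \<open>L\<close> yields nondegenerate overlaps.\<close>
lemma straight_from_local:
  fixes \<gamma> :: "real \<Rightarrow> 'a::real_inner" and L :: "real \<Rightarrow> real"
  assumes contL: "continuous_on {a..b} L" and "\<epsilon> > 0"
    and loc: "\<And>s t. a \<le> s \<Longrightarrow> s \<le> t \<Longrightarrow> t \<le> b \<Longrightarrow> L t - L s < \<epsilon> \<Longrightarrow> norm (\<gamma> t - \<gamma> s) = L t - L s"
    and "a \<le> s" "s \<le> t" "t \<le> b"
  shows "norm (\<gamma> t - \<gamma> s) = L t - L s"
proof -
  have "norm (\<gamma> t - \<gamma> s) = L t - L s"
    if "L t - L s < real n * (\<epsilon>/3)" "a \<le> s" "s \<le> t" "t \<le> b" for n s t
    using that
  proof (induction n arbitrary: s t)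
    case 0
    then show ?case using loc[of s t] \<open>\<epsilon> > 0\<close> by simp
  next
    case (Suc n)
    show ?case
    proof (cases "L t - L s < \<epsilon>")
      case True
      then show ?thesis using loc Suc.prems by blast
    next
      case False
      have "continuous_on {s..t} L"
        using contL by (rule continuous_on_subset) (use Suc.prems in auto)
      \<comment> \<open>Cutting in steps of \<open>\<epsilon>/3\<close> leaves
        \<open>L t - L r1 = 2*\<epsilon>/3 < \<epsilon>\<close>, so \<open>loc\<close> covers
        everything after \<open>r1\<close>, while both cuts are near enough to \<open>s\<close> for
        the induction hypothesis.\<close>
      then obtain r1 where r1: "s \<le> r1" "r1 \<le> t" "L r1 = L t - 2*\<epsilon>/3"
        using IVT'[of L s "L t - 2*\<epsilon>/3" t] False \<open>\<epsilon> > 0\<close> Suc.prems by auto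
      have "continuous_on {r1..t} L"
        using contL by (rule continuous_on_subset) (use Suc.prems r1 in auto)
      then obtain r2 where r2: "r1 \<le> r2" "r2 \<le> t" "L r2 = L t - \<epsilon>/3"
        using IVT'[of L r1 "L t - \<epsilon>/3" t] r1 \<open>\<epsilon> > 0\<close> by auto
      define x y z where "x = \<gamma> r1 - \<gamma> s" and "y = \<gamma> r2 - \<gamma> r1" and "z = \<gamma> t - \<gamma> r2"
      have small: "L r1 - L s < real n * (\<epsilon>/3)" "L r2 - L s < real n * (\<epsilon>/3)"
        using Suc.prems(1) r1 r2 \<open>\<epsilon> > 0\<close> by (auto simp: field_simps)
      have x: "norm x = L r1 - L s" unfolding x_def
        using Suc.IH[OF small(1)] r1 r2 Suc.prems by auto
      have "norm (\<gamma> r2 - \<gamma> s) = L r2 - L s"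
        using Suc.IH[OF small(2)] r1 r2 Suc.prems by auto
      then have xy: "norm (x + y) = L r2 - L s" by (simp add: x_def y_def)
      have y: "norm y = L r2 - L r1" unfolding y_def
        by (rule loc) (use r1 r2 \<open>\<epsilon> > 0\<close> Suc.prems in auto)
      have z: "norm z = L t - L r2" unfolding z_def
        by (rule loc) (use r1 r2 \<open>\<epsilon> > 0\<close> Suc.prems in auto)
      have "norm (\<gamma> t - \<gamma> r1) = L t - L r1"
        by (rule loc) (use r1 r2 \<open>\<epsilon> > 0\<close> Suc.prems in auto)
      then have yz: "norm (y + z) = L t - L r1" by (simp add: z_def y_def)
      have pos: "norm y > 0" unfolding y using r1 r2 \<open>\<epsilon> > 0\<close> by simp
      \<comment> \<open>Equality in the triangle inequality forces equal directions. The overlap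
        \<open>y\<close> is nonzero, so it transmits the direction of \<open>x\<close> to
        \<open>z\<close>.\<close>
      have "norm x *\<^sub>R y = norm y *\<^sub>R x" "norm y *\<^sub>R z = norm z *\<^sub>R y"
        using norm_triangle_eq[of x y] norm_triangle_eq[of y z] x y z xy yz by auto
      then have "norm y *\<^sub>R (x + y + z) = (norm x + norm y + norm z) *\<^sub>R y"
        by (simp add: algebra_simps)
      then have "norm y * norm (x + y + z) = (norm x + norm y + norm z) * norm y"
        by (metis abs_of_nonneg add_nonneg_nonneg norm_ge_zero norm_scaleR)
      then have "norm (x + y + z) = norm x + norm y + norm z" using pos by simp
      then show ?thesis unfolding x y z by (simp add: x_def y_def z_def)
    qed
  qed
  moreover obtain n :: nat where "(L t - L s) / (\<epsilon>/3) < real n"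
    using reals_Archimedean2 by blast
  then have "L t - L s < real n * (\<epsilon>/3)" using \<open>\<epsilon> > 0\<close> by (simp add: field_simps)
  ultimately show ?thesis using assms by blast
qed

text \<open>The chord is traversed at constant speed on the same parameter interval, so the rest of
  the curve keeps its parametrisation and the lengths differ only by the integral over
  \<open>{s..t}\<close>.\<close>

lemma shortcut:
  assumes "curve_in Y A B \<gamma>" "0 \<le> s" "s < t" "t \<le> 1" "closed_segment (\<gamma> s) (\<gamma> t) \<subseteq> Y"
  obtains \<delta> where "curve_in Y A B \<delta>"
    "curve_length \<delta> = curve_length \<gamma>
       - integral {s..t} (\<lambda>r. norm (vector_derivative \<gamma> (at r))) + norm (\<gamma> t - \<gamma> s)"
proof -
  define v where "v = (\<gamma> t - \<gamma> s) /\<^sub>R (t - s)"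
  define \<sigma> where "\<sigma> = (\<lambda>r. \<gamma> s + (r - s) *\<^sub>R v)"
  define \<delta> where "\<delta> = (\<lambda>r. if r \<in> {s..t} then \<sigma> r else \<gamma> r)"
  let ?f = "\<lambda>r. norm (vector_derivative \<gamma> (at r))" and ?g = "\<lambda>r. norm (vector_derivative \<delta> (at r))"
  have \<gamma>: "pw_C2 0 1 \<gamma>" "\<gamma> 0 = A" "\<gamma> 1 = B" "\<gamma> ` {0..1} \<subseteq> Y"
    using assms(1) unfolding curve_in_def piecewise_C2_iff_pw_C2 by auto
  have \<sigma>: "\<sigma> s = \<gamma> s" "\<sigma> t = \<gamma> t" using assms(3) by (auto simp: \<sigma>_def v_def)
  have left: "\<delta> r = \<gamma> r" if "r \<le> s" for r using that \<sigma> by (auto simp: \<delta>_def)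
  have right: "\<delta> r = \<gamma> r" if "t \<le> r" for r using that \<sigma> by (auto simp: \<delta>_def)
  have mid: "pw_C2 s t \<delta>"
    by (rule pw_C2_cong[OF pw_C2.single[OF \<open>s < t\<close> C2_on_affine[of _ "\<gamma> s" s v]]])
       (auto simp: \<delta>_def \<sigma>_def)
  \<comment> \<open>\<open>pw_C2\<close> holds only on nondegenerate intervals, hence the separate
    cases \<open>s = 0\<close> and, below, \<open>t = 1\<close>.\<close>
  have 0: "pw_C2 0 t \<delta>"
  proof (cases "s = 0")
    case False
    then have "pw_C2 0 s \<delta>"
      using pw_C2_cong[OF pw_C2_subinterval[OF \<gamma>(1), of 0 s]] left assms by auto
    then show ?thesis using mid pw_C2_append by blast
  qed (use mid in simp)
  have \<delta>: "pw_C2 0 1 \<delta>"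
  proof (cases "t = 1")
    case False
    then have "pw_C2 t 1 \<delta>"
      using pw_C2_cong[OF pw_C2_subinterval[OF \<gamma>(1), of t 1]] right assms by auto
    then show ?thesis using 0 pw_C2_append by blast
  qed (use 0 in simp)
  have "\<delta> r \<in> Y" if "r \<in> {0..1}" for r
  proof (cases "r \<in> {s..t}")
    case True
    have "\<sigma> r = (1 - (r - s)/(t - s)) *\<^sub>R \<gamma> s + ((r - s)/(t - s)) *\<^sub>R \<gamma> t"
      by (simp add: \<sigma>_def v_def algebra_simps divide_inverse)
    moreover have "0 \<le> (r - s)/(t - s)" "(r - s)/(t - s) \<le> 1" using True assms(3) by auto
    ultimately have "\<sigma> r \<in> closed_segment (\<gamma> s) (\<gamma> t)" unfolding in_segment by blast
    then show ?thesis using True assms(5) by (auto simp: \<delta>_def)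
  next
    case False
    then show ?thesis using \<gamma>(4) that by (auto simp: \<delta>_def)
  qed
  moreover have "\<delta> 0 = A" "\<delta> 1 = B" using left[of 0] right[of 1] assms \<gamma> by auto
  ultimately have "curve_in Y A B \<delta>"
    using \<delta> unfolding curve_in_def piecewise_C2_iff_pw_C2 by auto
  moreover have "curve_length \<delta> = curve_length \<gamma> - integral {s..t} ?f + norm (\<gamma> t - \<gamma> s)"
  proof -
    \<comment> \<open>Equality of the functions near \<open>r\<close> suffices, so this also holds
      at corners of \<open>\<gamma>\<close>, where \<open>vector_derivative\<close> may be a mere
      default value.\<close>
    have eq: "vector_derivative \<delta> (at r) = vector_derivative \<gamma> (at r)" if "r \<notin> {s..t}" for r
    proof (rule vector_derivative_cong_eq)
      show "\<forall>\<^sub>F x in nhds r. x \<in> UNIV \<longrightarrow> \<delta> x = \<gamma> x"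
        by (rule eventually_mono[OF eventually_nhds_in_open[of "- {s..t}" r]])
           (use that in \<open>auto simp: \<delta>_def\<close>)
    qed auto
    have eq': "vector_derivative \<delta> (at r) = v" if "r \<in> {s<..<t}" for r
    proof -
      have "vector_derivative \<delta> (at r) = vector_derivative \<sigma> (at r)"
      proof (rule vector_derivative_cong_eq)
        show "\<forall>\<^sub>F x in nhds r. x \<in> UNIV \<longrightarrow> \<delta> x = \<sigma> x"
          by (rule eventually_mono[OF eventually_nhds_in_open[of "{s<..<t}" r]])
             (use that in \<open>auto simp: \<delta>_def\<close>)
      qed auto
      also have "\<dots> = v"
        by (rule vector_derivative_at) (auto simp: \<sigma>_def intro!: derivative_eq_intros)
      finally show ?thesis .
    qed
    have split: "integral {0..s} h + integral {s..t} h + integral {t..1} h = integral {0..1} h"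
      if "h integrable_on {0..1}" for h :: "real \<Rightarrow> real"
    proof -
      have "integral {0..s} h + integral {s..1} h = integral {0..1} h"
        by (rule Henstock_Kurzweil_Integration.integral_combine) (use assms that in auto)
      moreover have "integral {s..t} h + integral {t..1} h = integral {s..1} h"
        by (rule Henstock_Kurzweil_Integration.integral_combine)
           (use assms in \<open>auto intro: integrable_on_subinterval[OF that]\<close>)
      ultimately show ?thesis by simp
    qed
    have "integral {0..s} ?g = integral {0..s} ?f"
      by (rule integral_spike[of "{s}"]) (use eq in auto)
    moreover have "integral {t..1} ?g = integral {t..1} ?f"
      by (rule integral_spike[of "{t}"]) (use eq in auto)
    moreover have "integral {s..t} ?g = integral {s..t} (\<lambda>_. norm v)"
      by (rule integral_spike[of "{s,t}"]) (use eq' in auto)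
    moreover have "integral {s..t} (\<lambda>_. norm v) = norm (\<gamma> t - \<gamma> s)"
      using assms(3) by (simp add: v_def)
    ultimately show ?thesis
      using split[of ?f] split[of ?g] pw_C2_speed_integral[OF \<gamma>(1)] pw_C2_speed_integral[OF \<delta>]
      unfolding curve_length_def by simp
  qed
  ultimately show ?thesis using that by blast
qed

text \<open>Compactness of the image makes the room for shortcuts uniform: one
  \<open>\<epsilon>\<close> serves all points of the curve. Only the image is determined; the curve
  may pause but cannot turn back.\<close>

theorem shortest_curve_in_open:
  assumes "open Y" "shortest_curve Y A B \<gamma>"
  shows "\<gamma> ` {0..1} = closed_segment A B"
proof -
  have cin: "curve_in Y A B \<gamma>" and min: "\<And>\<delta>. curve_in Y A B \<delta> \<Longrightarrow> curve_length \<gamma> \<le> curve_length \<delta>"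
    using assms(2) unfolding shortest_curve_def by auto
  then have \<gamma>: "pw_C2 0 1 \<gamma>" "\<gamma> 0 = A" "\<gamma> 1 = B" "\<gamma> ` {0..1} \<subseteq> Y"
    unfolding curve_in_def piecewise_C2_iff_pw_C2 by auto
  let ?f = "\<lambda>t. norm (vector_derivative \<gamma> (at t))"
  define L where "L = (\<lambda>t. integral {0..t} ?f)"
  have int: "?f integrable_on {0..1}" using pw_C2_speed_integral[OF \<gamma>(1)] by blast
  have cont: "continuous_on {0..1} L"
    unfolding L_def by (rule indefinite_integral_continuous_1[OF int])
  have diff: "L t - L s = integral {s..t} ?f" if "0 \<le> s" "s \<le> t" "t \<le> 1" for s t
    using Henstock_Kurzweil_Integration.integral_combine[OF that(1,2) integrable_on_subinterval[OF int, of 0 t]] that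
    by (auto simp: L_def)
  have le: "norm (\<gamma> t - \<gamma> s) \<le> L t - L s" if "0 \<le> s" "s \<le> t" "t \<le> 1" for s t
    using pw_C2_speed_integral[OF pw_C2_subinterval[OF \<gamma>(1), of s t]] diff[of s t] that
    by (cases "s = t") auto
  have c\<gamma>: "continuous_on {0..1} \<gamma>" using \<gamma>(1) by (rule pw_C2_imp_continuous_on)
  obtain \<epsilon> where \<epsilon>: "\<epsilon> > 0" "(\<Union>x\<in>\<gamma> ` {0..1}. ball x \<epsilon>) \<subseteq> Y"
    using compact_subset_open_imp_ball_epsilon_subset[OF compact_continuous_image[OF c\<gamma>] assms(1) \<gamma>(4)]
    by auto
  have loc: "norm (\<gamma> t - \<gamma> s) = L t - L s" if st: "0 \<le> s" "s \<le> t" "t \<le> 1" "L t - L s < \<epsilon>" for s t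
  proof (cases "s = t")
    case False
    have "\<gamma> t \<in> ball (\<gamma> s) \<epsilon>" using le[of s t] st by (auto simp: dist_norm norm_minus_commute)
    then have "closed_segment (\<gamma> s) (\<gamma> t) \<subseteq> ball (\<gamma> s) \<epsilon>"
      using \<epsilon>(1) by (intro closed_segment_subset) auto
    also have "\<dots> \<subseteq> Y" using \<epsilon>(2) st by (metis UN_subset_iff atLeastAtMost_iff image_eqI order_trans)
    finally obtain \<delta> where "curve_in Y A B \<delta>"
      "curve_length \<delta> = curve_length \<gamma> - integral {s..t} ?f + norm (\<gamma> t - \<gamma> s)"
      using shortcut[OF cin, of s t] st False by auto
    then have "L t - L s \<le> norm (\<gamma> t - \<gamma> s)" using min diff[of s t] st by fastforce
    then show ?thesis using le[of s t] st by simp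
  qed simp
  have glob: "norm (\<gamma> t - \<gamma> s) = L t - L s" if "0 \<le> s" "s \<le> t" "t \<le> 1" for s t
    using straight_from_local[OF cont \<epsilon>(1) loc] that by blast
  have sub: "\<gamma> ` {0..1} \<subseteq> closed_segment A B"
  proof (rule image_subsetI)
    fix t :: real assume "t \<in> {0..1}"
    then have "dist A B = dist A (\<gamma> t) + dist (\<gamma> t) B"
      using glob[of 0 t] glob[of t 1] glob[of 0 1] \<gamma> by (simp add: dist_norm norm_minus_commute)
    then show "\<gamma> t \<in> closed_segment A B" by (simp flip: between_mem_segment add: between)
  qed
  \<comment> \<open>For collinear sets connectedness and convexity agree; this fills the segment
    between the endpoints.\<close>
  moreover have "convex (\<gamma> ` {0..1})"
    using convex_connected_collinear[of "\<gamma> ` {0..1}"] connected_continuous_image[OF c\<gamma>]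
      collinear_subset[OF collinear_closed_segment sub] by auto
  then have "closed_segment A B \<subseteq> \<gamma> ` {0..1}"
    using \<gamma> by (intro closed_segment_subset) force+
  ultimately show ?thesis by blast
qed

text \<open>The closure is compact, convex and collinear, hence a closed segment, and a convex set
  contains the relative interior of its closure. Only the membership of the two ends stays open, as
  \<open>straight_segment\<close> permits.\<close>

lemma convex_subset_segment_cases:
  fixes C :: "(real \<times> real) set"
  assumes "convex C" "C \<subseteq> closed_segment A B" "C \<noteq> {}"
  shows "(\<exists>p. C = {p}) \<or> straight_segment C"
proof -
  have "closure C \<subseteq> closed_segment A B" using assms(2) by (simp add: closure_minimal)
  then have "compact (closure C)" "collinear (closure C)"
    by (auto intro: collinear_subset[OF collinear_closed_segment] bounded_subset[OF bounded_closed_segment]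
        simp: compact_eq_bounded_closed)
  then obtain a b where ab: "closure C = closed_segment a b"
    using compact_convex_collinear_segment[of "closure C"] convex_closure[OF assms(1)] assms(3)
      closure_eq_empty by metis
  show ?thesis
  proof (cases "a = b")
    case True
    then have "C \<subseteq> {a}" using ab closure_subset[of C] by auto
    then show ?thesis using assms(3) by blast
  next
    case False
    have "open_segment a b = rel_interior (closure C)" using False ab by (simp add: rel_interior_closed_segment)
    also have "\<dots> \<subseteq> C" using assms(1) by (simp add: convex_rel_interior_closure rel_interior_subset)
    finally show ?thesis unfolding straight_segment_def using False ab closure_subset by metis
  qed
qed

theorem finiteness_property_convex_cells:
  assumes "open Y" "\<And>e. e \<in> \<A> \<Longrightarrow> convex e"
  shows "finiteness_property Y \<A>"
  unfolding finiteness_property_def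
proof (intro allI impI ballI)
  fix A B \<gamma> e assume sc: "shortest_curve Y A B \<gamma>" and e: "e \<in> \<A>"
  let ?C = "\<gamma> ` {0..1} \<inter> e"
  have eq: "\<gamma> ` {0..1} = closed_segment A B" by (rule shortest_curve_in_open[OF assms(1) sc])
  then have conv: "convex ?C" using assms(2)[OF e] by (simp add: convex_Int)
  show "?C = {} \<or> finite (components ?C) \<and>
        (\<forall>C\<in>components ?C. (\<exists>p. C = {p}) \<or> geodesic_segment \<A> C)"
  proof (cases "?C = {}")
    case False
    then have "components ?C = {?C}"
      by (simp only: components_eq_sing_iff convex_connected[OF conv] not_False_eq_True simp_thms)
    then show ?thesis
      using convex_subset_segment_cases[OF conv _ False, of A B] eq
      by (simp add: geodesic_segment_def) blast
  qed simp
qed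

section \<open>Characteristic maps and CW complexes\<close>

text \<open>Inner lists hold coefficients in x, the outer list those in y:
  \<open>[:[:-a, 1:]:]\<close> is x - a, and \<open>[:[:-a:], 1:]\<close> below is y - a.\<close>

lemma semialgebraic_fst_gt: "{z. fst z > a} \<in> semialgebraic"
  using sa_pos[of "[:[:-a, 1:]:]"] by (simp add: peval2_def map_poly_pCons)

lemma semialgebraic_snd_gt: "{z. snd z > a} \<in> semialgebraic"
  using sa_pos[of "[:[:-a:], 1:]"] by (simp add: peval2_def map_poly_pCons)

lemma semialgebraic_fst_lt: "{z. fst z < a} \<in> semialgebraic"
  using sa_pos[of "[:[:a, -1:]:]"] by (simp add: peval2_def map_poly_pCons)

lemma semialgebraic_snd_lt: "{z. snd z < a} \<in> semialgebraic"
  using sa_pos[of "[:[:a:], -1:]"] by (simp add: peval2_def map_poly_pCons)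

lemma semialgebraic_fst_eq: "{z. fst z = a} \<in> semialgebraic"
  using sa_zero[of "[:[:-a, 1:]:]"] by (simp add: peval2_def map_poly_pCons)

lemma semialgebraic_snd_eq: "{z. snd z = a} \<in> semialgebraic"
  using sa_zero[of "[:[:-a:], 1:]"] by (simp add: peval2_def map_poly_pCons)

text \<open>Equal ends give a point instead of the empty set, so one product formula covers
  vertices, edges and squares.\<close>

definition open_int :: "real \<Rightarrow> real \<Rightarrow> real set" where
  "open_int a b = (if a = b then {a} else {a<..<b})"

lemma semialgebraic_open_int: "open_int a b \<times> open_int c d \<in> semialgebraic"
proof -
  have "{z. fst z \<in> open_int a b} \<in> semialgebraic"
    using sa_inter[OF semialgebraic_fst_gt[of a] semialgebraic_fst_lt[of b]] semialgebraic_fst_eq[of a]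
    by (auto simp: open_int_def Int_def)
  moreover have "{z. snd z \<in> open_int c d} \<in> semialgebraic"
    using sa_inter[OF semialgebraic_snd_gt[of c] semialgebraic_snd_lt[of d]] semialgebraic_snd_eq[of c]
    by (auto simp: open_int_def Int_def)
  ultimately have "{z. fst z \<in> open_int a b} \<inter> {z. snd z \<in> open_int c d} \<in> semialgebraic"
    by (rule sa_inter)
  also have "{z. fst z \<in> open_int a b} \<inter> {z. snd z \<in> open_int c d} = open_int a b \<times> open_int c d"
    by auto
  finally show ?thesis .
qed

lemma convex_open_int: "convex (open_int a b)"
  by (simp add: open_int_def)

section \<open>Characteristic maps of points, segments and rectangles\<close>

definition box_dim :: "real \<Rightarrow> real \<Rightarrow> real \<Rightarrow> real \<Rightarrow> nat" where
  "box_dim a b c d = of_bool (a < b) + of_bool (c < d)"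

text \<open>Invariance of domain, applied to the map and to its inverse.\<close>

lemma homeomorphism_image_interior:
  fixes f :: "'a::euclidean_space \<Rightarrow> 'a"
  assumes "homeomorphism S T f g"
  shows "f ` interior S = interior T"
proof -
  have *: "f ` interior S \<subseteq> interior T" if "homeomorphism S T f g" for S T and f g :: "'a \<Rightarrow> 'a"
  proof -
    have "inj_on f S" by (rule inj_on_inverseI) (rule homeomorphism_apply1[OF that])
    then show ?thesis
      using continuous_image_subset_interior[OF homeomorphism_cont1[OF that]] homeomorphism_image1[OF that]
      by (simp add: image_subset_iff_funcset)
  qed
  show ?thesis
  proof (rule antisym[OF *[OF assms]], rule subsetI)
    fix y assume y: "y \<in> interior T"
    have "g y \<in> interior S" using *[OF homeomorphism_symD[OF assms]] y by blast
    moreover have "f (g y) = y"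
      using homeomorphism_apply2[OF assms] y interior_subset by blast
    ultimately show "y \<in> f ` interior S" by (metis image_eqI)
  qed
qed

text \<open>Compact convex sets with nonempty interior are homeomorphic to the ball; as interiors
  correspond, whichever homeomorphism is chosen sends the open disk onto the open rectangle.\<close>

lemma characteristic_map_rectangle:
  fixes a b c d :: real
  assumes "a < b" "c < d"
  obtains \<Phi> \<Psi> where "homeomorphism (cball (0::real\<times>real) 1) ({a..b} \<times> {c..d}) \<Phi> \<Psi>"
    "\<Phi> ` ball 0 1 = {a<..<b} \<times> {c<..<d}"
proof -
  have int: "interior ({a..b} \<times> {c..d}) = {a<..<b} \<times> {c<..<d}"
    using interior_cbox[of a b] interior_cbox[of c d] by (simp add: interior_Times)
  have "cball (0::real\<times>real) 1 homeomorphic {a..b} \<times> {c..d}"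
  proof (rule homeomorphic_convex_compact)
    show "interior ({a..b} \<times> {c..d}) \<noteq> {}" using int assms by simp
  qed (auto intro: convex_Times compact_Times)
  then obtain \<Phi> \<Psi> where h: "homeomorphism (cball (0::real\<times>real) 1) ({a..b} \<times> {c..d}) \<Phi> \<Psi>"
    unfolding homeomorphic_def by blast
  show ?thesis using that[OF h] homeomorphism_image_interior[OF h] int by simp
qed

text \<open>Segments have empty interior in the plane, so the argument by interiors does not apply
  to edges there; an explicit affine map keeps track of the endpoints.\<close>

lemma interval_homeomorphism:
  fixes a b :: real
  assumes "a < b"
  obtains f g where "homeomorphism {-1..1::real} {a..b} f g" "f ` {-1<..<1} = {a<..<b}"
proof -
  let ?f = "\<lambda>x. (a+b)/2 + x * ((b-a)/2)" and ?g = "\<lambda>x. (x - (a+b)/2) / ((b-a)/2)"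
  have "(b-a)/2 \<noteq> 0" using assms by simp
  then have inv: "?f (?g y) = y" "?g (?f x) = x" for x y
    by (simp_all only: nonzero_eq_divide_eq times_divide_eq_left nonzero_mult_div_cancel_right) auto
  have f: "?f x \<in> {a..b} \<longleftrightarrow> x \<in> {-1..1}" "?f x \<in> {a<..<b} \<longleftrightarrow> x \<in> {-1<..<1}" for x
  proof -
    have "?f x - a = (x + 1) * ((b-a)/2)" "b - ?f x = (1 - x) * ((b-a)/2)"
      by (simp_all add: field_simps)
    then have "0 \<le> ?f x - a \<longleftrightarrow> 0 \<le> x + 1" "0 \<le> b - ?f x \<longleftrightarrow> 0 \<le> 1 - x"
      "0 < ?f x - a \<longleftrightarrow> 0 < x + 1" "0 < b - ?f x \<longleftrightarrow> 0 < 1 - x"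
      using assms by (simp_all only: zero_le_mult_iff zero_less_mult_iff) auto
    then show "?f x \<in> {a..b} \<longleftrightarrow> x \<in> {-1..1}" "?f x \<in> {a<..<b} \<longleftrightarrow> x \<in> {-1<..<1}"
      by auto
  qed
  have "homeomorphism {-1..1} {a..b} ?f ?g"
  proof (rule homeomorphismI)
    show "continuous_on {-1..1} ?f" "continuous_on {a..b} ?g"
      using assms by (auto intro!: continuous_intros)
    show "?f ` {-1..1} \<subseteq> {a..b}" using f(1) by blast
    show "?g ` {a..b} \<subseteq> {-1..1}"
    proof (rule image_subsetI)
      fix y assume "y \<in> {a..b}"
      then have "?f (?g y) \<in> {a..b}" by (simp only: inv(1))
      then show "?g y \<in> {-1..1}" using f(1) by blast
    qed
    show "?g (?f x) = x" "?f (?g y) = y" for x y by (rule inv)+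
  qed
  moreover have "?f ` {-1<..<1} = {a<..<b}"
  proof (rule antisym)
    show "?f ` {-1<..<1} \<subseteq> {a<..<b}" using f(2) by blast
    show "{a<..<b} \<subseteq> ?f ` {-1<..<1}"
    proof
      fix y assume "y \<in> {a<..<b}"
      then have "?f (?g y) \<in> {a<..<b}" by (simp only: inv(1))
      then have "?g y \<in> {-1<..<1}" using f(2) by blast
      from imageI[OF this, of ?f] show "y \<in> ?f ` {-1<..<1}" by (simp only: inv(1))
    qed
  qed
  ultimately show ?thesis by (rule that)
qed

lemma characteristic_map:
  assumes "a \<le> b" "c \<le> d"
  shows "\<exists>\<Phi> \<Psi>. homeomorphism (disk (box_dim a b c d)) ({a..b} \<times> {c..d}) \<Phi> \<Psi> \<and>
           \<Phi> ` open_disk (box_dim a b c d) = open_int a b \<times> open_int c d"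
proof -
  consider "a = b" "c = d" | "a < b" "c = d" | "a = b" "c < d" | "a < b" "c < d"
    using assms by linarith
  then show ?thesis
  proof cases
    case 1
    then show ?thesis
      by (intro exI[of _ "\<lambda>_. (a,c)"] exI[of _ "\<lambda>_. (0,0)"])
         (auto simp: homeomorphism_def disk_def open_disk_def box_dim_def open_int_def)
  next
    case 2
    obtain f g where fg: "homeomorphism {-1..1::real} {a..b} f g" "f ` {-1<..<1} = {a<..<b}"
      using interval_homeomorphism[OF 2(1)] by blast
    have "homeomorphism ({-1..1} \<times> {0::real}) ({a..b} \<times> {c}) (\<lambda>z. (f (fst z), c)) (\<lambda>z. (g (fst z), 0))"
    proof (rule homeomorphismI)
      show "continuous_on ({-1..1} \<times> {0::real}) (\<lambda>z. (f (fst z), c))"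
        by (intro continuous_on_Pair continuous_on_const continuous_on_compose2[OF homeomorphism_cont1[OF fg(1)]]
              continuous_on_fst continuous_on_snd continuous_on_id) auto
      show "continuous_on ({a..b} \<times> {c}) (\<lambda>z. (g (fst z), 0::real))"
        by (intro continuous_on_Pair continuous_on_const continuous_on_compose2[OF homeomorphism_cont2[OF fg(1)]]
              continuous_on_fst continuous_on_snd continuous_on_id) auto
    qed (use homeomorphism_image1[OF fg(1)] homeomorphism_image2[OF fg(1)]
          homeomorphism_apply1[OF fg(1)] homeomorphism_apply2[OF fg(1)] in auto)
    moreover have "(\<lambda>z. (f (fst z), c)) ` ({-1<..<1} \<times> {0::real}) = {a<..<b} \<times> {c}"
      unfolding fg(2)[symmetric] by force
    ultimately show ?thesis
      using 2 by (intro exI conjI) (simp_all add: disk_def open_disk_def box_dim_def open_int_def)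
  next
    case 3
    obtain f g where fg: "homeomorphism {-1..1::real} {c..d} f g" "f ` {-1<..<1} = {c<..<d}"
      using interval_homeomorphism[OF 3(2)] by blast
    have "homeomorphism ({-1..1} \<times> {0::real}) ({a} \<times> {c..d}) (\<lambda>z. (a, f (fst z))) (\<lambda>z. (g (snd z), 0))"
    proof (rule homeomorphismI)
      show "continuous_on ({-1..1} \<times> {0::real}) (\<lambda>z. (a, f (fst z)))"
        by (intro continuous_on_Pair continuous_on_const continuous_on_compose2[OF homeomorphism_cont1[OF fg(1)]]
              continuous_on_fst continuous_on_snd continuous_on_id) auto
      show "continuous_on ({a} \<times> {c..d}) (\<lambda>z. (g (snd z), 0::real))"
        by (intro continuous_on_Pair continuous_on_const continuous_on_compose2[OF homeomorphism_cont2[OF fg(1)]]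
              continuous_on_fst continuous_on_snd continuous_on_id) auto
    qed (use homeomorphism_image1[OF fg(1)] homeomorphism_image2[OF fg(1)]
          homeomorphism_apply1[OF fg(1)] homeomorphism_apply2[OF fg(1)] in auto)
    moreover have "(\<lambda>z. (a, f (fst z))) ` ({-1<..<1} \<times> {0::real}) = {a} \<times> {c<..<d}"
      unfolding fg(2)[symmetric] by force
    ultimately show ?thesis
      using 3 by (intro exI conjI) (simp_all add: disk_def open_disk_def box_dim_def open_int_def)
  next
    case 4
    then have "disk (box_dim a b c d) = cball 0 1" "open_disk (box_dim a b c d) = ball 0 1"
      "open_int a b = {a<..<b}" "open_int c d = {c<..<d}"
      by (simp_all add: box_dim_def disk_def open_disk_def open_int_def)
    then show ?thesis using characteristic_map_rectangle[OF 4] by metis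
  qed
qed

text \<open>Local finiteness yields both remaining axioms: a compact closure is covered by finitely
  many neighbourhoods that each meet finitely many cells, and a locally finite union of relatively
  closed sets is relatively closed.\<close>

lemma CW_complexI:
  assumes dec: "cell_decomposition Y \<A>"
    and char: "\<And>e. e \<in> \<A> \<Longrightarrow> \<exists>n \<Phi>. is_cell n e \<and> continuous_on (disk n) \<Phi> \<and> \<Phi> ` disk n \<subseteq> Y \<and>
                   (\<exists>\<Psi>. homeomorphism (open_disk n) e \<Phi> \<Psi>) \<and>
                   \<Phi> ` disk_boundary n \<subseteq> skeleton_below \<A> n"
    and clo: "\<And>e. e \<in> \<A> \<Longrightarrow> compact (closure e) \<and> closure e \<subseteq> Y"
    and fin: "\<And>x. x \<in> Y \<Longrightarrow> \<exists>U. open U \<and> x \<in> U \<and> finite {e\<in>\<A>. e \<inter> U \<noteq> {}}"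
  shows "CW_complex Y \<A>"
proof -
  have "finite {e'\<in>\<A>. e' \<inter> (Y \<inter> closure e) \<noteq> {}}" if e: "e \<in> \<A>" for e
  proof -
    have "\<forall>x\<in>Y. \<exists>U. open U \<and> x \<in> U \<and> finite {e\<in>\<A>. e \<inter> U \<noteq> {}}" using fin by blast
    from bchoice[OF this] obtain U where
      U: "\<And>x. x \<in> Y \<Longrightarrow> open (U x) \<and> x \<in> U x \<and> finite {e\<in>\<A>. e \<inter> U x \<noteq> {}}"
      by auto
    have cl: "compact (closure e)" "closure e \<subseteq> Y" using clo e by auto
    obtain D where D: "D \<subseteq> closure e" "finite D" "closure e \<subseteq> (\<Union>x\<in>D. U x)"
    proof (rule compactE_image[OF cl(1), of "closure e" U])
      show "open (U x)" if "x \<in> closure e" for x using U cl(2) that by blast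
      show "closure e \<subseteq> (\<Union>x\<in>closure e. U x)" using U cl(2) by blast
    qed
    have "finite {e\<in>\<A>. e \<inter> U x \<noteq> {}}" if "x \<in> D" for x using U D(1) cl(2) that by blast
    with D(2) have "finite (\<Union>x\<in>D. {e\<in>\<A>. e \<inter> U x \<noteq> {}})" by (rule finite_UN_I)
    moreover have "{e'\<in>\<A>. e' \<inter> (Y \<inter> closure e) \<noteq> {}} \<subseteq> (\<Union>x\<in>D. {e\<in>\<A>. e \<inter> U x \<noteq> {}})"
    proof
      fix e' assume "e' \<in> {e'\<in>\<A>. e' \<inter> (Y \<inter> closure e) \<noteq> {}}"
      then obtain y where y: "e' \<in> \<A>" "y \<in> e'" "y \<in> closure e" by blast
      then obtain x where "x \<in> D" "y \<in> U x" using D(3) by blast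
      with y show "e' \<in> (\<Union>x\<in>D. {e\<in>\<A>. e \<inter> U x \<noteq> {}})" by blast
    qed
    ultimately show ?thesis using finite_subset by blast
  qed
  moreover have "closedin (top_of_set Y) A"
    if A: "A \<subseteq> Y" "\<forall>e\<in>\<A>. closedin (top_of_set (Y \<inter> closure e)) (A \<inter> (Y \<inter> closure e))" for A
  proof -
    have "closedin (top_of_set Y) (\<Union>((\<lambda>e. A \<inter> (Y \<inter> closure e)) ` \<A>))"
    proof (rule closedin_locally_finite_Union)
      fix S assume "S \<in> (\<lambda>e. A \<inter> (Y \<inter> closure e)) ` \<A>"
      then obtain e where e: "e \<in> \<A>" "S = A \<inter> (Y \<inter> closure e)" by blast
      have "closedin (top_of_set Y) (Y \<inter> closure e)" by (simp add: closedin_closed_Int)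
      then show "closedin (top_of_set Y) S" using A(2) e closedin_trans by blast
    next
      show "locally_finite_in (top_of_set Y) ((\<lambda>e. A \<inter> (Y \<inter> closure e)) ` \<A>)"
        unfolding locally_finite_in_def
      proof (intro conjI ballI)
        fix x assume "x \<in> topspace (top_of_set Y)"
        then have "x \<in> Y" by simp
        then obtain U where U: "open U" "x \<in> U" "finite {e\<in>\<A>. e \<inter> U \<noteq> {}}"
          using fin by blast
        \<comment> \<open>An open set that meets \<open>closure e\<close> meets \<open>e\<close>, so
          local finiteness passes from cells to their closures.\<close>
        have "{S \<in> (\<lambda>e. A \<inter> (Y \<inter> closure e)) ` \<A>. S \<inter> (Y \<inter> U) \<noteq> {}}
              \<subseteq> (\<lambda>e. A \<inter> (Y \<inter> closure e)) ` {e\<in>\<A>. e \<inter> U \<noteq> {}}"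
          using open_Int_closure_eq_empty[OF U(1)] by blast
        then show "\<exists>V. openin (top_of_set Y) V \<and> x \<in> V \<and>
            finite {S \<in> (\<lambda>e. A \<inter> (Y \<inter> closure e)) ` \<A>. S \<inter> V \<noteq> {}}"
          using U(1,2) finite_subset[OF _ finite_imageI[OF U(3)]]
          by (intro exI[of _ "Y \<inter> U"]) (simp add: openin_open_Int \<open>x \<in> Y\<close>)
      qed auto
    qed
    moreover have "\<Union>((\<lambda>e. A \<inter> (Y \<inter> closure e)) ` \<A>) = A"
    proof
      show "A \<subseteq> \<Union>((\<lambda>e. A \<inter> (Y \<inter> closure e)) ` \<A>)"
      proof
        fix x assume x: "x \<in> A"
        then obtain e where "e \<in> \<A>" "x \<in> e" using A(1) dec unfolding cell_decomposition_def by blast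
        then show "x \<in> \<Union>((\<lambda>e. A \<inter> (Y \<inter> closure e)) ` \<A>)"
          using x A(1) closure_subset[of e] by blast
      qed
    qed blast
    ultimately show ?thesis by simp
  qed
  moreover have "closedin (top_of_set (Y \<inter> closure e)) (A \<inter> (Y \<inter> closure e))"
    if "closedin (top_of_set Y) A" for A e
    using that unfolding closedin_closed by blast
  ultimately show ?thesis unfolding CW_complex_def using dec char by blast
qed

section \<open>Dyadic cells\<close>

text \<open>Together \<open>dfloor n t\<close> and \<open>dceil n t\<close> encode the cell of
  \<open>t\<close> in the grid of mesh \<open>1/2^n\<close> on the line: they coincide at a grid
  point and are the ends of the open interval around \<open>t\<close> otherwise.\<close>

definition dfloor :: "nat \<Rightarrow> real \<Rightarrow> real" where "dfloor n t = of_int \<lfloor>2^n * t\<rfloor> / 2^n"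
definition dceil :: "nat \<Rightarrow> real \<Rightarrow> real" where "dceil n t = of_int \<lceil>2^n * t\<rceil> / 2^n"

lemma dfloor_le: "dfloor n t \<le> t" and le_dceil: "t \<le> dceil n t"
  by (simp_all add: dfloor_def dceil_def field_simps)

lemma dfloor_greatest: "of_int k / 2^n \<le> t \<Longrightarrow> of_int k / 2^n \<le> dfloor n t"
  by (simp add: dfloor_def divide_le_cancel le_floor_iff field_simps)

lemma dceil_least: "t \<le> of_int k / 2^n \<Longrightarrow> dceil n t \<le> of_int k / 2^n"
  by (simp add: dceil_def divide_le_cancel ceiling_le_iff field_simps)

lemma dyadic_refine: "m \<le> n \<Longrightarrow> real_of_int k / 2^m = real_of_int (k * 2^(n-m)) / 2^n"
  by (simp add: field_simps flip: power_add)

lemma dfloor_refine: "m \<le> n \<Longrightarrow> dfloor m t \<le> dfloor n t"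
  using dfloor_greatest[of "\<lfloor>2^m * t\<rfloor> * 2^(n-m)" n t] dfloor_le[of m t] dyadic_refine[of m n]
  by (simp only: dfloor_def)

lemma dceil_refine: "m \<le> n \<Longrightarrow> dceil n t \<le> dceil m t"
  using dceil_least[of t "\<lceil>2^m * t\<rceil> * 2^(n-m)" n] le_dceil[of t m] dyadic_refine[of m n]
  by (simp only: dceil_def)

text \<open>The closed interval of \<open>t\<close> at level \<open>m\<close> contains
  \<open>s\<close> and has grid points of level \<open>m\<close> as ends, so extremality of floor
  and ceiling applies. The case \<open>m = n\<close> treats faces, \<open>m < n\<close>
  coarsening.\<close>

lemma dfloor_dceil_nest:
  assumes "dfloor n t \<le> s" "s \<le> dceil n t" "m \<le> n"
  shows "dfloor m t \<le> dfloor m s" "dceil m s \<le> dceil m t"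
proof -
  have "dfloor m t \<le> s" using dfloor_refine[OF assms(3), of t] assms(1) by simp
  then show "dfloor m t \<le> dfloor m s" using dfloor_greatest by (simp add: dfloor_def)
  have "s \<le> dceil m t" using dceil_refine[OF assms(3), of t] assms(2) by simp
  then show "dceil m s \<le> dceil m t" using dceil_least by (simp add: dceil_def)
qed

lemma dfloor_dceil_cases:
  "dfloor n t = t \<and> dceil n t = t \<or> dfloor n t < t \<and> t < dceil n t \<and> dceil n t = dfloor n t + 1 / 2^n"
proof (cases "2^n * t \<in> \<int>")
  case True
  then obtain k where "2^n * t = of_int k" by (auto elim: Ints_cases)
  moreover from this have "t = of_int k / 2^n" by (simp add: field_simps)
  ultimately show ?thesis by (simp add: dfloor_def dceil_def)
next
  case False
  then have "real_of_int \<lceil>2^n * t\<rceil> = real_of_int \<lfloor>2^n * t\<rfloor> + 1"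
    by (metis Ints_of_int ceiling_altdef of_int_1 of_int_add)
  moreover have "real_of_int \<lfloor>2^n * t\<rfloor> < 2^n * t" "2^n * t < real_of_int \<lceil>2^n * t\<rceil>"
    using False by (metis Ints_of_int of_int_floor_le order_le_less, metis Ints_of_int le_of_int_ceiling order_le_less)
  ultimately show ?thesis by (auto simp: dfloor_def dceil_def field_simps)
qed

text \<open>Grid intervals of level \<open>n\<close> have length 0 or \<open>1/2^n\<close>, so one
  properly contained in another is a point.\<close>

lemma boundary_point_is_dyadic:
  assumes "dfloor n t \<le> s" "s \<le> dceil n t" "\<not> (dfloor n s = dfloor n t \<and> dceil n s = dceil n t)"
  shows "dfloor n s = dceil n s \<and> dfloor n t < dceil n t"
  using dfloor_dceil_nest[OF assms(1,2) order_refl] assms(3) dfloor_dceil_cases[of n s] dfloor_dceil_cases[of n t]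
  by linarith

text \<open>Membership becomes equality of rounding data, which makes the cells of one level
  equivalence classes.\<close>

lemma mem_open_int_dfloor_dceil:
  "s \<in> open_int (dfloor n t) (dceil n t) \<longleftrightarrow> dfloor n s = dfloor n t \<and> dceil n s = dceil n t"
proof (cases "dfloor n t = dceil n t")
  case True
  then show ?thesis
    using dfloor_dceil_cases[of n t] dfloor_dceil_cases[of n s] by (auto simp: open_int_def)
next
  case False
  have "dfloor n s = dfloor n t \<and> dceil n s = dceil n t" if s: "dfloor n t < s" "s < dceil n t"
  proof (rule ccontr)
    assume "\<not> ?thesis"
    then have "dfloor n s = dceil n s" using boundary_point_is_dyadic[of n t s] s by simp
    then have "dfloor n s = s" "dceil n s = s" using dfloor_dceil_cases[of n s] by auto
    then have s_eq: "of_int \<lfloor>2^n * s\<rfloor> / 2^n = s" "of_int \<lceil>2^n * s\<rceil> / 2^n = s"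
      by (simp_all add: dfloor_def dceil_def)
    show False
    proof (cases "s \<le> t")
      case True
      then show False using dfloor_greatest[of "\<lfloor>2^n * s\<rfloor>" n t] s_eq s by simp
    next
      case False
      then show False using dceil_least[of t "\<lceil>2^n * s\<rceil>" n] s_eq s by simp
    qed
  qed
  then show ?thesis using False dfloor_dceil_cases[of n s] by (auto simp: open_int_def)
qed

lemma finite_dfloor_image: "finite (dfloor n ` {a..b})"
proof (rule finite_surj)
  show "dfloor n ` {a..b} \<subseteq> (\<lambda>k. of_int k / 2^n) ` {\<lfloor>2^n * a\<rfloor>..\<lfloor>2^n * b\<rfloor>}"
    by (auto simp: dfloor_def intro!: image_eqI floor_mono)
qed simp

lemma finite_dceil_image: "finite (dceil n ` {a..b})"
proof (rule finite_surj)
  show "dceil n ` {a..b} \<subseteq> (\<lambda>k. of_int k / 2^n) ` {\<lceil>2^n * a\<rceil>..\<lceil>2^n * b\<rceil>}"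
    by (auto simp: dceil_def intro!: image_eqI ceiling_mono)
qed simp

section \<open>The planar grid of a fixed level\<close>

definition dcell :: "nat \<Rightarrow> real \<times> real \<Rightarrow> (real \<times> real) set" where
  "dcell n z = open_int (dfloor n (fst z)) (dceil n (fst z)) \<times> open_int (dfloor n (snd z)) (dceil n (snd z))"

definition dbox :: "nat \<Rightarrow> real \<times> real \<Rightarrow> (real \<times> real) set" where
  "dbox n z = {dfloor n (fst z)..dceil n (fst z)} \<times> {dfloor n (snd z)..dceil n (snd z)}"

definition ddim :: "nat \<Rightarrow> real \<times> real \<Rightarrow> nat" where
  "ddim n z = box_dim (dfloor n (fst z)) (dceil n (fst z)) (dfloor n (snd z)) (dceil n (snd z))"

lemma mem_dcell:
  "w \<in> dcell n z \<longleftrightarrow> dfloor n (fst w) = dfloor n (fst z) \<and> dceil n (fst w) = dceil n (fst z) \<and>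
     dfloor n (snd w) = dfloor n (snd z) \<and> dceil n (snd w) = dceil n (snd z)"
  by (auto simp: dcell_def mem_Times_iff mem_open_int_dfloor_dceil)

lemma mem_dcell_self: "z \<in> dcell n z"
  by (simp add: mem_dcell)

lemma mem_dbox_self: "z \<in> dbox n z"
  by (simp add: dbox_def mem_Times_iff dfloor_le le_dceil)

lemma dcell_eq: "w \<in> dcell n z \<Longrightarrow> dcell n w = dcell n z"
  unfolding mem_dcell by (simp add: dcell_def)

lemma dbox_eq: "w \<in> dcell n z \<Longrightarrow> dbox n w = dbox n z"
  by (simp add: mem_dcell dbox_def)

lemma dcell_subset_dbox: "dcell n z \<subseteq> dbox n z"
  using dbox_eq mem_dbox_self by blast

text \<open>Incidence survives coarsening; for \<open>m = n\<close> this says that faces of faces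
  are faces.\<close>

lemma dbox_nest: "w \<in> dbox n z \<Longrightarrow> m \<le> n \<Longrightarrow> dbox m w \<subseteq> dbox m z"
  unfolding dbox_def mem_Times_iff
  by (intro Sigma_mono) (auto dest: dfloor_dceil_nest)

lemma dist_dbox:
  assumes "z \<in> dbox n w" "v \<in> dbox n w"
  shows "dist z v \<le> 2 / 2^n"
proof -
  have *: "dceil n t \<le> dfloor n t + 1 / 2^n" for t using dfloor_dceil_cases[of n t] by auto
  have "dist (fst z) (fst v) \<le> 1 / 2^n" "dist (snd z) (snd v) \<le> 1 / 2^n"
    using assms *[of "fst w"] *[of "snd w"]
    by (auto simp: dbox_def mem_Times_iff dist_real_def)
  \<comment> \<open>Bounding the distance by the sum of the coordinate distances gives the constant
    2.\<close>
  moreover have "dist z v \<le> dist (fst z) (fst v) + dist (snd z) (snd v)"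
    by (cases z; cases v) (simp add: dist_Pair_Pair sqrt_sum_squares_le_sum)
  ultimately show ?thesis by simp
qed

text \<open>A coordinate on a grid line stays on it under refinement, so a point can only lose
  dimension.\<close>

lemma ddim_refine:
  assumes "m \<le> n" shows "ddim n z \<le> ddim m z"
proof -
  have "of_bool (dfloor n t < dceil n t) \<le> (of_bool (dfloor m t < dceil m t) :: nat)" for t
    using dfloor_refine[OF assms, of t] dceil_refine[OF assms, of t] by auto
  then show ?thesis unfolding ddim_def box_dim_def by (intro add_mono)
qed

text \<open>Some coordinate of \<open>w\<close> is an end of a nondegenerate interval and drops to
  dimension 0; the other coordinate cannot gain.\<close>

lemma ddim_boundary:
  assumes "w \<in> dbox n z" "w \<notin> dcell n z"
  shows "ddim n w < ddim n z"
proof -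
  have 1: "of_bool (dfloor n s < dceil n s) \<le> (of_bool (dfloor n t < dceil n t) :: nat)"
    if "dfloor n t \<le> s" "s \<le> dceil n t" for s t
    using dfloor_dceil_nest[OF that order_refl] by auto
  have 2: "of_bool (dfloor n s < dceil n s) < (of_bool (dfloor n t < dceil n t) :: nat)"
    if "dfloor n t \<le> s" "s \<le> dceil n t" "\<not> (dfloor n s = dfloor n t \<and> dceil n s = dceil n t)" for s t
    using boundary_point_is_dyadic[OF that] by auto
  have b: "dfloor n (fst z) \<le> fst w" "fst w \<le> dceil n (fst z)" "dfloor n (snd z) \<le> snd w" "snd w \<le> dceil n (snd z)"
    using assms(1) by (auto simp: dbox_def mem_Times_iff)
  from assms(2) consider "\<not> (dfloor n (fst w) = dfloor n (fst z) \<and> dceil n (fst w) = dceil n (fst z))"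
    | "\<not> (dfloor n (snd w) = dfloor n (snd z) \<and> dceil n (snd w) = dceil n (snd z))"
    by (auto simp: mem_dcell)
  then show ?thesis
    using 1[OF b(1,2)] 1[OF b(3,4)] 2[OF b(1,2)] 2[OF b(3,4)]
    unfolding ddim_def box_dim_def by cases (auto intro: add_less_le_mono add_le_less_mono)
qed

lemma finite_dcells: "finite (dcell n ` ({a..b} \<times> {c..d}))"
proof (rule finite_surj)
  show "dcell n ` ({a..b} \<times> {c..d}) \<subseteq> (\<lambda>(p, q, r, s). open_int p q \<times> open_int r s) `
      (dfloor n ` {a..b} \<times> dceil n ` {a..b} \<times> dfloor n ` {c..d} \<times> dceil n ` {c..d})"
    by (force simp: dcell_def)
qed (intro finite_cartesian_product finite_dfloor_image finite_dceil_image)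

lemma countable_dcells: "countable (range (dcell n))"
proof -
  have "range (dcell n) \<subseteq> (\<lambda>(i, j, k, l). open_int (of_int i / 2^n) (of_int j / 2^n) \<times>
      open_int (of_int k / 2^n) (of_int l / 2^n)) ` (UNIV :: (int \<times> int \<times> int \<times> int) set)"
    by (force simp: dcell_def dfloor_def dceil_def)
  then show ?thesis by (rule countable_subset) simp
qed

text \<open>The quantifier over \<open>w\<close> demands the closed star of the cell of \<open>z\<close> to lie in \<open>Y\<close>, not just its
  closure. This passes from a face to the cells around it, so that a selected edge has no vertex of a
  finer selected cell in its interior (no T-junctions).\<close>
definition star_inside :: "(real \<times> real) set \<Rightarrow> nat \<Rightarrow> real \<times> real \<Rightarrow> bool" where
  "star_inside Y n z \<longleftrightarrow> (\<forall>w. z \<in> dbox n w \<longrightarrow> dbox n w \<subseteq> Y)"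

text \<open>Natural-number levels cap the side length at 1, so a largest admissible cell exists even
  if \<open>Y\<close> is the whole plane.\<close>

definition level :: "(real \<times> real) set \<Rightarrow> real \<times> real \<Rightarrow> nat" where
  "level Y z = (LEAST n. star_inside Y n z)"

definition dyadic_cells :: "(real \<times> real) set \<Rightarrow> (real \<times> real) set set" where
  "dyadic_cells Y = (\<lambda>z. dcell (level Y z) z) ` Y"

section \<open>Selecting levels by stars\<close>

lemma star_inside_dbox_subset: "star_inside Y n z \<Longrightarrow> dbox n z \<subseteq> Y"
  using mem_dbox_self unfolding star_inside_def by blast

text \<open>A closed cell containing \<open>y\<close> contains all of \<open>dbox n y\<close>, hence
  \<open>x\<close>; so the star of a cell lies in the star of each of its faces.\<close>

lemma star_inside_mono: "star_inside Y n x \<Longrightarrow> x \<in> dbox n y \<Longrightarrow> star_inside Y n y"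
  unfolding star_inside_def using dbox_nest[OF _ order_refl] by blast

lemma star_inside_ball:
  assumes "ball z r \<subseteq> Y" "2 / 2^n < r"
  shows "star_inside Y n z"
  unfolding star_inside_def
proof (intro allI impI subsetI)
  fix w v assume "z \<in> dbox n w" "v \<in> dbox n w"
  then have "dist z v < r" using dist_dbox assms(2) by fastforce
  then show "v \<in> Y" using assms(1) by auto
qed

lemma obtain_fine_level:
  fixes r :: real assumes "r > 0" obtains n :: nat where "2 / 2^n < r"
proof -
  obtain n where "(1/2::real)^n < r/2" using real_arch_pow_inv[of "r/2" "1/2"] assms by auto
  then have "2 / 2^n < r" by (simp add: power_divide field_simps)
  then show ?thesis by (rule that)
qed

lemma star_inside_level:
  assumes "open Y" "z \<in> Y" shows "star_inside Y (level Y z) z"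
proof -
  obtain r where "r > 0" "ball z r \<subseteq> Y" using assms open_contains_ball by blast
  moreover from this obtain n :: nat where "2 / 2^n < r" using obtain_fine_level by blast
  ultimately show ?thesis unfolding level_def using star_inside_ball by (metis LeastI)
qed

lemma level_le: "star_inside Y n z \<Longrightarrow> level Y z \<le> n"
  unfolding level_def by (rule Least_le)

lemma level_mono_dbox:
  assumes "open Y" "x \<in> dbox (level Y y) y" "y \<in> Y"
  shows "level Y y \<le> level Y x"
proof (rule ccontr)
  assume "\<not> ?thesis"
  then have less: "level Y x < level Y y" by simp
  have "x \<in> Y" using star_inside_dbox_subset[OF star_inside_level] assms by blast
  have "x \<in> dbox (level Y x) y"
    using dbox_nest[OF assms(2), of "level Y x"] less mem_dbox_self by fastforce
  then have "star_inside Y (level Y x) y" using star_inside_mono star_inside_level[OF assms(1) \<open>x \<in> Y\<close>] by blast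
  then show False using level_le less by fastforce
qed

text \<open>The level depends only on the cell, so any point of a selected cell can represent it;
  disjointness follows from this.\<close>

lemma level_dcell:
  assumes "open Y" "x \<in> dcell (level Y y) y" "y \<in> Y"
  shows "level Y x = level Y y"
proof (rule antisym)
  have "y \<in> dbox (level Y y) x" using assms(2) dbox_eq mem_dbox_self by blast
  then show "level Y x \<le> level Y y" using star_inside_mono star_inside_level assms level_le by blast
  show "level Y y \<le> level Y x" using level_mono_dbox assms dcell_subset_dbox by blast
qed

lemma dyadic_cells_eq:
  assumes "open Y" "e \<in> dyadic_cells Y" "x \<in> e"
  shows "e = dcell (level Y x) x \<and> x \<in> Y"
proof -
  obtain y where y: "y \<in> Y" "e = dcell (level Y y) y" using assms(2) by (auto simp: dyadic_cells_def)
  have "x \<in> Y" using star_inside_dbox_subset[OF star_inside_level[OF assms(1) y(1)]] dcell_subset_dbox y assms(3) by blast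
  then show ?thesis using level_dcell[OF assms(1)] y assms(3) dcell_eq by metis
qed

text \<open>Points within \<open>r/2\<close> of \<open>x\<close> have a ball of radius
  \<open>r/2\<close> inside \<open>Y\<close>, so one \<open>n\<close> bounds all their levels; a
  bounded region meets finitely many cells of each level.\<close>

lemma dyadic_cells_locally_finite:
  assumes "open Y" "x \<in> Y"
  shows "\<exists>U. open U \<and> x \<in> U \<and> finite {e \<in> dyadic_cells Y. e \<inter> U \<noteq> {}}"
proof -
  obtain r where r: "r > 0" "ball x r \<subseteq> Y" using assms open_contains_ball by blast
  then obtain n :: nat where n: "2 / 2^n < r/2" using obtain_fine_level[of "r/2"] by auto
  let ?U = "ball x (r/2)" and ?B = "{fst x - r..fst x + r} \<times> {snd x - r..snd x + r}"
  have "{e \<in> dyadic_cells Y. e \<inter> ?U \<noteq> {}} \<subseteq> (\<Union>m\<le>n. dcell m ` ?B)"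
  proof
    fix e assume "e \<in> {e \<in> dyadic_cells Y. e \<inter> ?U \<noteq> {}}"
    then obtain y where e: "e \<in> dyadic_cells Y" and y: "y \<in> e" "dist x y < r/2" by auto
    have "ball y (r/2) \<subseteq> ball x r"
    proof
      fix v assume "v \<in> ball y (r/2)"
      then show "v \<in> ball x r" using dist_triangle[of x v y] y(2) by simp
    qed
    then have "level Y y \<le> n" using star_inside_ball[OF _ n] level_le r(2) by blast
    moreover have "e = dcell (level Y y) y" using dyadic_cells_eq[OF assms(1) e y(1)] by blast
    moreover have "y \<in> ?B"
      using dist_fst_le[of x y] dist_snd_le[of x y] y(2) by (auto simp: mem_Times_iff dist_real_def)
    ultimately show "e \<in> (\<Union>m\<le>n. dcell m ` ?B)" by blast
  qed
  then have "finite {e \<in> dyadic_cells Y. e \<inter> ?U \<noteq> {}}"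
    by (rule finite_subset) (simp add: finite_dcells)
  then show ?thesis using r(1) by (intro exI[of _ ?U]) auto
qed

section \<open>The CW structure on dyadic cells\<close>

text \<open>One map serves the closed box and the open cell, so injectivity keeps the boundary of
  the disk off the open cell.\<close>

lemma dcell_is_cell:
  obtains \<Phi> \<Psi> where "homeomorphism (disk (ddim n z)) (dbox n z) \<Phi> \<Psi>"
    "homeomorphism (open_disk (ddim n z)) (dcell n z) \<Phi> \<Psi>"
    "\<Phi> ` disk_boundary (ddim n z) \<subseteq> dbox n z - dcell n z" "is_cell (ddim n z) (dcell n z)"
proof -
  let ?k = "ddim n z"
  have k: "?k \<le> 2" by (simp add: ddim_def box_dim_def)
  have le: "dfloor n t \<le> dceil n t" for t using dfloor_le[of n t] le_dceil[of t n] by simp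
  obtain \<Phi> \<Psi> where h: "homeomorphism (disk ?k) (dbox n z) \<Phi> \<Psi>" "\<Phi> ` open_disk ?k = dcell n z"
    using characteristic_map[OF le[of "fst z"] le[of "snd z"]]
    unfolding ddim_def dbox_def dcell_def by blast
  have sub: "open_disk ?k \<subseteq> disk ?k" "disk_boundary ?k \<subseteq> disk ?k - open_disk ?k"
    by (auto simp: disk_def open_disk_def disk_boundary_def)
  have o: "homeomorphism (open_disk ?k) (dcell n z) \<Phi> \<Psi>"
    using homeomorphism_of_subsets[OF h(1) sub(1) _ h(2)] dcell_subset_dbox by blast
  have "inj_on \<Phi> (disk ?k)" using h(1) unfolding homeomorphism_def by (metis inj_on_inverseI)
  then have "\<Phi> ` (disk ?k - open_disk ?k) = dbox n z - dcell n z"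
    using inj_on_image_set_diff[of \<Phi> "disk ?k" "disk ?k" "open_disk ?k"] sub h
    by (metis Diff_subset homeomorphism_image1)
  then have "\<Phi> ` disk_boundary ?k \<subseteq> dbox n z - dcell n z" using sub(2) by blast
  moreover have "is_cell ?k (dcell n z)"
    using k o homeomorphic_sym unfolding is_cell_def homeomorphic_def by (metis homeomorphism_symD)
  ultimately show ?thesis using that h(1) o by blast
qed

lemma cell_decomposition_dyadic_cells:
  assumes "open Y" shows "cell_decomposition Y (dyadic_cells Y)"
  unfolding cell_decomposition_def
proof (intro conjI ballI impI)
  have "dyadic_cells Y \<subseteq> (\<Union>n. range (dcell n))" by (auto simp: dyadic_cells_def)
  then show "countable (dyadic_cells Y)"
    by (rule countable_subset) (auto intro: countable_dcells)
  show "\<Union>(dyadic_cells Y) = Y"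
  proof (rule antisym)
    show "\<Union>(dyadic_cells Y) \<subseteq> Y" using dyadic_cells_eq[OF assms] by blast
    show "Y \<subseteq> \<Union>(dyadic_cells Y)" using mem_dcell_self by (auto simp: dyadic_cells_def)
  qed
  show "{} \<notin> dyadic_cells Y" using mem_dcell_self by (auto simp: dyadic_cells_def)
  show "e \<inter> e' = {}" if "e \<in> dyadic_cells Y" "e' \<in> dyadic_cells Y" "e \<noteq> e'" for e e'
    using dyadic_cells_eq[OF assms] that by blast
  show "e \<in> semialgebraic" "\<exists>n. is_cell n e" if e: "e \<in> dyadic_cells Y" for e
  proof -
    obtain n z where "e = dcell n z" using e by (auto simp: dyadic_cells_def)
    then show "e \<in> semialgebraic" "\<exists>n. is_cell n e"
      using semialgebraic_open_int dcell_is_cell by (simp add: dcell_def, metis)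
  qed
qed

theorem CW_complex_dyadic_cells:
  assumes "open Y" shows "CW_complex Y (dyadic_cells Y)"
proof (rule CW_complexI)
  fix e assume e: "e \<in> dyadic_cells Y"
  then obtain z where z: "z \<in> Y" "e = dcell (level Y z) z" by (auto simp: dyadic_cells_def)
  let ?n = "level Y z" let ?k = "ddim ?n z"
  have sub: "dbox ?n z \<subseteq> Y" using star_inside_dbox_subset star_inside_level assms z(1) by blast
  obtain \<Phi> \<Psi> where h: "homeomorphism (disk ?k) (dbox ?n z) \<Phi> \<Psi>" "homeomorphism (open_disk ?k) e \<Phi> \<Psi>"
    "\<Phi> ` disk_boundary ?k \<subseteq> dbox ?n z - e" "is_cell ?k e"
    using dcell_is_cell unfolding z(2) by blast
  have "dbox ?n z - e \<subseteq> skeleton_below (dyadic_cells Y) ?k"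
  proof
    fix x assume x: "x \<in> dbox ?n z - e"
    \<comment> \<open>At level \<open>?n\<close> a boundary point has smaller dimension than the
      cell, and passing to its own, possibly finer, level cannot raise it again.\<close>
    then have "?n \<le> level Y x" using level_mono_dbox[OF assms _ z(1)] by blast
    then have "ddim (level Y x) x \<le> ddim ?n x" by (rule ddim_refine)
    also have "\<dots> < ?k" using ddim_boundary x z(2) by blast
    finally have "ddim (level Y x) x < ?k" .
    moreover have "is_cell (ddim (level Y x) x) (dcell (level Y x) x)" using dcell_is_cell by blast
    moreover have "dcell (level Y x) x \<in> dyadic_cells Y" using x sub by (auto simp: dyadic_cells_def)
    ultimately show "x \<in> skeleton_below (dyadic_cells Y) ?k"
      unfolding skeleton_below_def using mem_dcell_self by blast
  qed
  then show "\<exists>n \<Phi>. is_cell n e \<and> continuous_on (disk n) \<Phi> \<and> \<Phi> ` disk n \<subseteq> Y \<and>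
       (\<exists>\<Psi>. homeomorphism (open_disk n) e \<Phi> \<Psi>) \<and>
       \<Phi> ` disk_boundary n \<subseteq> skeleton_below (dyadic_cells Y) n"
    using h sub homeomorphism_cont1[OF h(1)] homeomorphism_image1[OF h(1)]
    by (intro exI[of _ ?k] exI[of _ \<Phi>]) blast
  have "compact (dbox ?n z)" by (simp add: dbox_def compact_Times)
  moreover from this have "closure e \<subseteq> dbox ?n z"
    using dcell_subset_dbox z(2) by (simp add: closure_minimal compact_imp_closed)
  ultimately show "compact (closure e) \<and> closure e \<subseteq> Y"
    using sub by (metis closed_closure compact_Int_closed inf.absorb_iff2 order_trans)
qed (use assms cell_decomposition_dyadic_cells dyadic_cells_locally_finite in auto)

lemma convex_dyadic_cells: "e \<in> dyadic_cells Y \<Longrightarrow> convex e"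
  by (auto simp: dyadic_cells_def dcell_def intro!: convex_Times convex_open_int)

section \<open>Basic semialgebraic open sets\<close>

lemma continuous_on_peval2: "continuous_on UNIV (peval2 p)"
proof (induction p)
  case 0
  then show ?case by (simp add: peval2_def[abs_def])
next
  case (pCons c p)
  \<comment> \<open>Horner's rule in the outer variable.\<close>
  have "peval2 (pCons c p) = (\<lambda>z. poly c (fst z) + snd z * peval2 p z)"
    by (simp add: peval2_def[abs_def] map_poly_pCons)
  then show ?case using pCons.IH by (auto intro!: continuous_intros)
qed

lemma open_basic_union: "open (basic_union G)"
  unfolding basic_union_def
proof (intro open_UN ballI)
  fix gs assume "gs \<in> set G"
  have "{z. \<forall>g\<in>set gs. peval2 g z > 0} = (\<Inter>g\<in>set gs. {z. peval2 g z > 0})" by auto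
  also have "open \<dots>"
    by (intro open_INT ballI open_Collect_less continuous_on_peval2 continuous_on_const) simp
  finally show "open {z. \<forall>g\<in>set gs. peval2 g z > 0}" .
qed

theorem theorem3p5:
  fixes G :: "real poly poly list list" and Y :: "(real \<times> real) set"
  assumes "G \<noteq> []"
    and "\<forall>gs\<in>set G. gs \<noteq> []"
    and "\<forall>gs\<in>set G. \<forall>g\<in>set gs. irreducible g"
    and "Y = basic_union G"
  shows "\<exists>\<A>. cell_decomposition Y \<A> \<and> CW_complex Y \<A> \<and> finiteness_property Y \<A>"
proof -
  have "open Y" using assms(4) open_basic_union by simp
  then have "cell_decomposition Y (dyadic_cells Y)" "CW_complex Y (dyadic_cells Y)"
    "finiteness_property Y (dyadic_cells Y)"
    using cell_decomposition_dyadic_cells CW_complex_dyadic_cells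
      finiteness_property_convex_cells convex_dyadic_cells by blast+
  then show ?thesis by blast
qed

end
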